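(* Let $f \colon \mathbb{R}^n \to \mathbb{R}$ be lower semi-continuous. The following statements are equivalent: (i) $f$ is Lipschitz at infinity. (ii) $\partial f(\infty)$ is nonempty and compact. (iii) $f^{\uparrow}(\infty; v)$ is finite for all $v \in \mathbb{R}^n$. (iv) $f^{\dagger}(\infty; v)$ is finite for all $v \in \mathbb{R}^n$. (v) $f^0(\infty; v)$ is finite for all $v \in \mathbb{R}^n$. (vi) $\partial^{\infty} f(\infty)=\{0\}$, where $\partial^{\infty} f(\infty) := \{\xi \in \mathbb{R}^n \mid (\xi, 0) \in N_{\mathrm{epi} f}(\infty_I)\}$.
   Context: $\mathbb{R}^n$ carries the Euclidean norm and inner product; $\mathbb{B}_\epsilon(v)$ is the closed ball of radius $\epsilon$ centered at $v$, $\mathbb{B}_R := \mathbb{B}_R(0)$; $t_k \searrow 0$ means $t_k>0$ and $t_k$ decreases to $0$. $f\colon\mathbb{R}^n\to\mathbb{R}$ is Lipschitz at infinity if there exist $L>0$ and $R>0$ with $|f(x)-f(x')|\le L\|x-x'\|$ for all $x,x'\in\mathbb{R}^n\setminus\mathbb{B}_R$. $\mathrm{epi} f := \{(x,y) \in \mathbb{R}^n\times\mathbb{R} \mid f(x)\le y\}$. $I=\{1,\ldots,n\}$, regarded as a subset of $\{1,\ldots,n+1\}$. $T_{\mathrm{epi} f}(\infty_I)$ is the set of all $(v,r) \in \mathbb{R}^n\times\mathbb{R}$ such that for all sequences $(x_k,y_k)\in \mathrm{epi} f$ with $\|x_k\|\to\infty$ and $t_k\searrow 0$ there exists $(v_k,r_k)\to(v,r)$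 with $(x_k,y_k)+t_k(v_k,r_k)\in\mathrm{epi} f$ for all $k$. $N_{\mathrm{epi} f}(\infty_I) := \{w \in \mathbb{R}^{n}\times\mathbb{R} \mid \langle z, w\rangle\le 0 \text{ for all } z \in T_{\mathrm{epi} f}(\infty_I)\}$. $\partial f(\infty) := \{\xi\in\mathbb{R}^n \mid (\xi,-1)\in N_{\mathrm{epi} f}(\infty_I)\}$. The following generalized derivatives at infinity take values in $[-\infty,+\infty]$: $$f^{\uparrow}(\infty; v) := \lim_{\epsilon \searrow 0}\ \limsup_{\|x\|\to\infty,\ t \searrow 0}\ \inf_{w \in \mathbb{B}_\epsilon(v)} \frac{f(x + t w) - f(x)}{t},$$ $$f^{\dagger}(\infty; v) := \limsup_{\|x\|\to\infty,\ t \searrow 0,\ w \to v} \frac{f(x + t w) - f(x)}{t},\qquad f^0(\infty; v) := \limsup_{\|x\| \to \infty,\ t \searrow 0} \frac{f(x + t v) - f(x)}{t}.$$ *)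

theory Defs
  imports "HOL-Analysis.Analysis"
begin

definition lower_semicontinuous :: "('a::topological_space \<Rightarrow> real) \<Rightarrow> bool" where
  "lower_semicontinuous f \<longleftrightarrow> (\<forall>x. ereal (f x) \<le> Liminf (at x) (\<lambda>z. ereal (f z)))"

definition lipschitz_at_infinity :: "('a::real_normed_vector \<Rightarrow> real) \<Rightarrow> bool" where
  "lipschitz_at_infinity f \<longleftrightarrow> (\<exists>L>0. \<exists>R>0. L-lipschitz_on (- cball 0 R) f)"

text \<open>
  The index set \<open>I = {1,\<dots>,n}\<close> of \<open>\<infinity>\<^sub>I\<close> selects the coordinates of
  \<open>\<real>\<^sup>n \<times> \<real>\<close> that must tend to infinity. Only the first component of the base points
  is required to do so; the second one is unrestricted.
\<close>

definition tangent_cone_infinity ::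
    "('a::real_normed_vector \<times> real) set \<Rightarrow> ('a \<times> real) set" where
  "tangent_cone_infinity E =
     {z. \<forall>(p :: nat \<Rightarrow> 'a \<times> real) (t :: nat \<Rightarrow> real).
           (\<forall>k. p k \<in> E) \<longrightarrow> filterlim (\<lambda>k. norm (fst (p k))) at_top sequentially \<longrightarrow>
           (\<forall>k. 0 < t k) \<longrightarrow> decseq t \<longrightarrow> t \<longlonglongrightarrow> 0 \<longrightarrow>
           (\<exists>q. q \<longlonglongrightarrow> z \<and> (\<forall>k. p k + t k *\<^sub>R q k \<in> E))}"

definition normal_cone_infinity ::
    "('a::real_inner \<times> real) set \<Rightarrow> ('a \<times> real) set" where
  "normal_cone_infinity E = {w. \<forall>z\<in>tangent_cone_infinity E. z \<bullet> w \<le> 0}"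

definition subdiff_infinity :: "('a::real_inner \<Rightarrow> real) \<Rightarrow> 'a set" where
  "subdiff_infinity f = {\<xi>. (\<xi>, -1) \<in> normal_cone_infinity (epigraph UNIV f)}"

definition singular_subdiff_infinity :: "('a::real_inner \<Rightarrow> real) \<Rightarrow> 'a set" where
  "singular_subdiff_infinity f = {\<xi>. (\<xi>, 0) \<in> normal_cone_infinity (epigraph UNIV f)}"

definition diff_quotient :: "('a::real_vector \<Rightarrow> real) \<Rightarrow> 'a \<Rightarrow> real \<Rightarrow> 'a \<Rightarrow> ereal" where
  "diff_quotient f x t w = ereal ((f (x + t *\<^sub>R w) - f x) / t)"

definition upper_subderiv_infinity :: "('a::real_normed_vector \<Rightarrow> real) \<Rightarrow> 'a \<Rightarrow> ereal" where
  "upper_subderiv_infinity f v =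
     Lim (at_right 0) (\<lambda>\<epsilon>::real.
       Limsup (at_infinity \<times>\<^sub>F at_right 0) (\<lambda>(x, t). INF w\<in>cball v \<epsilon>. diff_quotient f x t w))"

text \<open>\<open>Lim\<close> is a definite description; the limit above always exists, by monotonicity.\<close>

lemma upper_subderiv_infinity_tendsto:
  "((\<lambda>\<epsilon>::real. Limsup (at_infinity \<times>\<^sub>F at_right 0)
       (\<lambda>(x, t). INF w\<in>cball v \<epsilon>. diff_quotient f x t w))
     \<longlongrightarrow> upper_subderiv_infinity f v) (at_right 0)"
proof -
  define g where "g = (\<lambda>\<epsilon>::real. Limsup (at_infinity \<times>\<^sub>F at_right 0)
       (\<lambda>(x, t). INF w\<in>cball v \<epsilon>. diff_quotient f x t w))"
  have anti: "g e \<le> g d" if "d \<le> e" for d e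
    unfolding g_def using that
    by (intro Limsup_mono always_eventually) (auto intro!: INF_superset_mono)
  have "(g \<longlongrightarrow> (SUP e\<in>{0<..}. g e)) (at_right 0)"
  proof (rule increasing_tendsto)
    show "\<forall>\<^sub>F e in at_right 0. g e \<le> (SUP e\<in>{0<..}. g e)"
      unfolding eventually_at_right_field by (intro exI[of _ 1]) (auto intro: SUP_upper)
  next
    fix x assume "x < (SUP e\<in>{0<..}. g e)"
    then obtain d where d: "d > 0" "x < g d" by (auto simp: less_SUP_iff)
    then show "\<forall>\<^sub>F e in at_right 0. x < g e"
      unfolding eventually_at_right_field
      by (intro exI[of _ d]) (auto intro: less_le_trans[OF _ anti])
  qed
  moreover from this have "Lim (at_right 0) g = (SUP e\<in>{0<..}. g e)"
    by (intro tendsto_Lim) auto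
  ultimately show ?thesis
    by (simp add: upper_subderiv_infinity_def g_def)
qed

definition dagger_deriv_infinity :: "('a::real_normed_vector \<Rightarrow> real) \<Rightarrow> 'a \<Rightarrow> ereal" where
  "dagger_deriv_infinity f v =
     Limsup (at_infinity \<times>\<^sub>F at_right 0 \<times>\<^sub>F nhds v) (\<lambda>(x, t, w). diff_quotient f x t w)"

definition clarke_deriv_infinity :: "('a::real_normed_vector \<Rightarrow> real) \<Rightarrow> 'a \<Rightarrow> ereal" where
  "clarke_deriv_infinity f v =
     Limsup (at_infinity \<times>\<^sub>F at_right 0) (\<lambda>(x, t). diff_quotient f x t v)"

end

theory Submission
  imports Defs
begin

text \<open>
  Conditions (ii)--(vi) each imply a one-sided bound \<open>f (x + t w) \<le> f x + t r\<close> near infinity, for every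
  direction \<open>v\<close>, with a suitable \<open>w\<close> near \<open>v\<close>. Compactness of the unit sphere makes \<open>r\<close> uniform.
  If \<open>K\<close> is large compared with \<open>r\<close>, then moving from \<open>z \<noteq> y\<close> towards \<open>y\<close> strictly decreases
  \<open>f z + K \<parallel>z - y\<parallel>\<close>, so the minimum of this lower semicontinuous function over a ball around \<open>y\<close>
  is attained at \<open>y\<close> itself. This is \<open>f y \<le> f x + K \<parallel>x - y\<parallel>\<close>, a local Lipschitz bound with a
  uniform constant.

  The tangent cone at infinity is a convex cone. If the singular subdifferential is trivial, then
  separation shows that the cone projects onto all of the space, which is the one-sided bound. A
  nonzero singular subgradient is a recession direction of the subdifferential, so (ii) implies (vi).
  Conversely, under a Lipschitz bound \<open>L\<close> the cone contains all \<open>(v, L \<parallel>v\<parallel>)\<close> but not \<open>(0, -1)\<close>, and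
  separating this point from the cone produces a subgradient.
\<close>

section \<open>Base points escaping to infinity with vanishing step sizes\<close>

lemma eventually_at_infinity_at_right_0:
  "eventually P (at_infinity \<times>\<^sub>F at_right 0) \<longleftrightarrow>
     (\<exists>M. \<exists>\<delta>>0. \<forall>x t. M < norm x \<longrightarrow> 0 < t \<longrightarrow> t < \<delta> \<longrightarrow> P (x, t))"
    (is "?L \<longleftrightarrow> ?R")
  for P :: "'a::real_normed_vector \<times> real \<Rightarrow> bool"
proof
  assume ?L
  then obtain A B where A: "eventually A at_infinity" and B: "eventually B (at_right 0)"
    and AB: "\<And>x t. A x \<Longrightarrow> B t \<Longrightarrow> P (x, t)"
    unfolding eventually_prod_filter by auto
  obtain M where "\<And>x. M \<le> norm x \<Longrightarrow> A x" using A unfolding eventually_at_infinity by auto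
  moreover obtain \<delta> where "\<delta> > 0" "\<And>t. 0 < t \<Longrightarrow> t < \<delta> \<Longrightarrow> B t"
    using B unfolding eventually_at_right_field by auto
  ultimately show ?R using AB by (intro exI[of _ M] exI[of _ \<delta>]) auto
next
  assume ?R
  then obtain M \<delta> where *: "\<delta> > 0" "\<And>x t. M < norm x \<Longrightarrow> 0 < t \<Longrightarrow> t < \<delta> \<Longrightarrow> P (x, t)" by auto
  have "\<forall>\<^sub>F x::'a in at_infinity. M < norm x"
    unfolding eventually_at_infinity by (intro exI[of _ "M + 1"]) auto
  moreover have "\<forall>\<^sub>F t in at_right 0. 0 < t \<and> t < \<delta>"
    unfolding eventually_at_right_field using * by (intro exI[of _ \<delta>]) auto
  ultimately show ?L
    unfolding eventually_prod_filter using *(2) by blast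
qed

text \<open>A Euclidean space has vectors of every nonnegative norm, so the filter is proper. This
  is what carries an eventual lower bound over to the \<open>Limsup\<close>.\<close>

lemma at_infinity_at_right_0_nontrivial:
  "at_infinity \<times>\<^sub>F at_right 0 \<noteq> (bot :: ('a::euclidean_space \<times> real) filter)"
proof
  assume "at_infinity \<times>\<^sub>F at_right 0 = (bot :: ('a \<times> real) filter)"
  then have "\<forall>\<^sub>F p in at_infinity \<times>\<^sub>F at_right (0::real). (\<lambda>_::'a \<times> real. False) p" by simp
  then obtain M \<delta> where "\<delta> > 0" and *: "\<forall>(x::'a) (t::real). M < norm x \<longrightarrow> 0 < t \<longrightarrow> t < \<delta> \<longrightarrow> False"
    unfolding eventually_at_infinity_at_right_0 by blast
  obtain x :: 'a where "norm x = \<bar>M\<bar> + 1" using vector_choose_size[of "\<bar>M\<bar> + 1"] by auto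
  then show False using *[rule_format, of x "\<delta> / 2"] \<open>\<delta> > 0\<close> by linarith
qed

section \<open>Lower semicontinuity and attained minima\<close>

text \<open>The form of lower semicontinuity that feeds the covering argument for minima;
  \<open>h\<close> will be the penalty \<open>K * norm (z - y)\<close>.\<close>

lemma lower_semicontinuous_open_superlevel:
  assumes "lower_semicontinuous f" "continuous_on UNIV h"
  shows "open {z. c < f z + h z}"
proof (subst open_subopen, intro ballI)
  fix z assume z: "z \<in> {z. c < f z + h z}"
  \<comment> \<open>Half of the slack above \<open>c\<close>: \<open>f\<close> and \<open>h\<close>
    may each drop by \<open>e\<close>.\<close>
  define e where "e = (f z + h z - c) / 2"
  have e: "e > 0" using z by (simp add: e_def)
  have "ereal (f z) \<le> Liminf (at z) (\<lambda>z. ereal (f z))"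
    using assms by (simp add: lower_semicontinuous_def)
  then have "\<forall>\<^sub>F w in at z. ereal (f z - e) < ereal (f w)"
    unfolding le_Liminf_iff by (rule allE[of _ "ereal (f z - e)"]) (use e in simp)
  then have "\<forall>\<^sub>F w in at z. f z - e < f w" by simp
  then have f: "\<forall>\<^sub>F w in nhds z. f z - e < f w"
    using e by (subst eventually_nhds_conv_at) auto
  have "\<forall>\<^sub>F w in nhds z. h z - e < h w"
  proof -
    have "(h \<longlongrightarrow> h z) (nhds z)"
      using assms(2) by (metis UNIV_I continuous_on_def at_within_open tendsto_at_iff_tendsto_nhds open_UNIV)
    from order_tendstoD(1)[OF this, of "h z - e"] e show ?thesis by simp
  qed
  with f have "\<forall>\<^sub>F w in nhds z. w \<in> {z. c < f z + h z}"
  proof eventually_elim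
    case (elim w)
    have "2 * e = f z + h z - c" by (simp add: e_def)
    with elim show ?case by simp
  qed
  then show "\<exists>T. open T \<and> z \<in> T \<and> T \<subseteq> {z. c < f z + h z}"
    unfolding eventually_nhds by blast
qed

text \<open>If no minimum is attained, every point of \<open>C\<close> lies strictly above some
  value \<open>g u\<close> with \<open>u\<close> in \<open>C\<close>. Finitely many such
  \<open>u\<close> suffice by compactness, but the one with the least value is covered by none of
  them.\<close>

lemma compact_attains_min_if_open_superlevels:
  fixes g :: "'a::topological_space \<Rightarrow> real"
  assumes "compact C" "C \<noteq> {}" and op: "\<And>c. open {z. c < g z}"
  shows "\<exists>z\<in>C. \<forall>u\<in>C. g z \<le> g u"
proof (rule ccontr)
  assume contr: "\<not> (\<exists>z\<in>C. \<forall>u\<in>C. g z \<le> g u)"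
  then have ex: "\<exists>u\<in>C. g u < g z" if "z \<in> C" for z
    using contr that by (meson not_le)
  then have "C \<subseteq> (\<Union>u\<in>C. {z. g u < g z})" by auto
  with \<open>compact C\<close> op obtain D where D: "D \<subseteq> C" "finite D" "C \<subseteq> (\<Union>u\<in>D. {z. g u < g z})"
    by (rule compactE_image)
  with \<open>C \<noteq> {}\<close> have "D \<noteq> {}" by auto
  then obtain u where "u \<in> D" "\<forall>d\<in>D. g u \<le> g d"
    using D(2) by (metis arg_min_if_finite(1) arg_min_least)
  moreover from this D have "u \<in> (\<Union>u\<in>D. {z. g u < g z})" by blast
  ultimately show False by force
qed

section \<open>From small scales to a Lipschitz bound near infinity\<close>

text \<open>Repeated bisection: the midpoint stays in \<open>C\<close> and halves the distance, so a
  bound valid up to one scale holds up to twice that scale with the same \<open>K\<close>.\<close>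

lemma lipschitz_convex_if_small_scale:
  fixes f :: "'a::real_normed_vector \<Rightarrow> real"
  assumes C: "convex C" and "\<delta> > 0"
    and loc: "\<And>a b. a \<in> C \<Longrightarrow> b \<in> C \<Longrightarrow> norm (a - b) < \<delta> \<Longrightarrow> \<bar>f a - f b\<bar> \<le> K * norm (a - b)"
    and "x \<in> C" "y \<in> C"
  shows "\<bar>f x - f y\<bar> \<le> K * norm (x - y)"
proof -
  have step: "norm (a - b) < 2 ^ n * \<delta> \<Longrightarrow> a \<in> C \<Longrightarrow> b \<in> C \<Longrightarrow> \<bar>f a - f b\<bar> \<le> K * norm (a - b)" for n a b
  proof (induction n arbitrary: a b)
    case 0
    then show ?case using loc by simp
  next
    case (Suc n)
    let ?m = "midpoint a b"
    have m: "?m \<in> C" using Suc.prems C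
      by (meson closed_segment_subset midpoints_in_convex_hull midpoint_in_closed_segment subsetD)
    have na: "norm (a - ?m) = norm (a - b) / 2" "norm (?m - b) = norm (a - b) / 2"
      using dist_midpoint[of a b] by (simp_all add: dist_norm)
    have "\<bar>f a - f ?m\<bar> \<le> K * norm (a - ?m)" "\<bar>f ?m - f b\<bar> \<le> K * norm (?m - b)"
      using Suc m na by auto
    then have "\<bar>f a - f b\<bar> \<le> K * norm (a - ?m) + K * norm (?m - b)" by linarith
    then show ?case unfolding na by simp
  qed
  obtain n where "norm (x - y) / \<delta> < 2 ^ n" using real_arch_pow[of 2] by auto
  then show ?thesis using assms by (intro step[of _ _ n]) (auto simp: field_simps)
qed

text \<open>The exterior of a ball is not convex (on the line not even connected), so bisection
  covers only pairs whose segment stays at norm \<open>M\<close> or more. Any other pair has a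
  distance comparable to its norms, which pays for a detour through radial projections onto a
  sphere.\<close>

lemma lipschitz_at_infinity_if_small_scale:
  fixes f :: "'a::euclidean_space \<Rightarrow> real"
  assumes loc: "\<And>a b. M \<le> norm a \<Longrightarrow> M \<le> norm b \<Longrightarrow> norm (a - b) < 1 \<Longrightarrow> \<bar>f a - f b\<bar> \<le> K * norm (a - b)"
    and "M > 0" "K > 0"
  shows "lipschitz_at_infinity f"
proof -
  \<comment> \<open>Points beyond \<open>2 * M\<close> have more than half of their norm outside the
    ball of radius \<open>M\<close>; this gives \<open>far\<close> below.\<close>
  define R where "R = 2 * M"
  have R: "R > 0" "M < R" using assms by (auto simp: R_def)
  have seg: "\<bar>f a - f b\<bar> \<le> K * norm (a - b)" if "\<And>z. z \<in> closed_segment a b \<Longrightarrow> M \<le> norm z" for a b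
    by (rule lipschitz_convex_if_small_scale[of "closed_segment a b" 1]) (use that loc in auto)
  have "continuous_on (sphere 0 R) f"
  proof (rule continuous_onI)
    fix x :: 'a and e :: real assume x: "x \<in> sphere 0 R" and e: "e > 0"
    show "\<exists>d>0. \<forall>x'\<in>sphere 0 R. dist x' x < d \<longrightarrow> dist (f x') (f x) \<le> e"
    proof (intro exI[of _ "min 1 (e / K)"] conjI ballI impI)
      show "min 1 (e / K) > 0" using e \<open>K > 0\<close> by auto
    next
      fix x' assume x': "x' \<in> sphere 0 R" "dist x' x < min 1 (e / K)"
      then have "\<bar>f x' - f x\<bar> \<le> K * norm (x' - x)"
        using x R by (intro loc) (auto simp: dist_norm)
      also have "\<dots> \<le> e" using x'(2) \<open>K > 0\<close> by (simp add: dist_norm field_simps)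
      finally show "dist (f x') (f x) \<le> e" by (simp add: dist_real_def)
    qed
  qed
  then have "bounded (f ` sphere 0 R)"
    by (intro compact_imp_bounded compact_continuous_image) auto
  then obtain B where B: "B > 0" "\<And>x. norm x = R \<Longrightarrow> \<bar>f x\<bar> \<le> B"
    unfolding bounded_pos by auto
  \<comment> \<open>\<open>2 * K\<close> pays for the two radial legs and \<open>2 * B / R\<close>
    for the jump between their endpoints on the sphere, as the distance is at least half the sum of
    the norms.\<close>
  define L where "L = 2 * K + 2 * B / R"
  have "\<bar>f x - f y\<bar> \<le> L * norm (x - y)" if x: "R < norm x" and y: "R < norm y" for x y
  proof (cases "\<forall>z\<in>closed_segment x y. M \<le> norm z")
    case True
    then have "\<bar>f x - f y\<bar> \<le> K * norm (x - y)" by (intro seg) auto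
    also have "\<dots> \<le> L * norm (x - y)"
      using \<open>K > 0\<close> B R by (intro mult_right_mono) (auto simp: L_def intro: add_increasing2)
    finally show ?thesis .
  next
    case False
    then obtain z where z: "z \<in> closed_segment x y" "norm z < M" by force
    have "norm (x - y) = norm (x - z) + norm (z - y)"
      using z(1) by (simp flip: between_mem_segment dist_norm add: between)
    moreover have "norm x - norm z \<le> norm (x - z)" "norm y - norm z \<le> norm (z - y)"
      using norm_triangle_ineq2[of x z] norm_triangle_ineq2[of y z] by (auto simp: norm_minus_commute)
    ultimately have far: "norm x / 2 + norm y / 2 \<le> norm (x - y)"
      using z(2) x y by (simp add: R_def)
    have rad: "\<bar>f u - f ((R / norm u) *\<^sub>R u)\<bar> \<le> K * norm u" "norm ((R / norm u) *\<^sub>R u) = R"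
      if u: "R < norm u" for u
    proof -
      let ?u = "(R / norm u) *\<^sub>R u"
      show R': "norm ?u = R" using u R by auto
      have pos: "norm u > 0" using u R by linarith
      \<comment> \<open>Along the ray the norm is a convex combination of \<open>norm u\<close> and
        \<open>R\<close>, so the radial segment avoids the inner ball.\<close>
      have "M \<le> norm w" if "w \<in> closed_segment u ?u" for w
      proof -
        have "\<exists>s. 0 \<le> s \<and> s \<le> 1 \<and> w = (1 - s) *\<^sub>R u + s *\<^sub>R ?u"
          using that unfolding in_segment .
        then obtain s where s: "0 \<le> s \<and> s \<le> 1 \<and> w = (1 - s) *\<^sub>R u + s *\<^sub>R ?u" ..
        then have "w = ((1 - s) + s * (R / norm u)) *\<^sub>R u" unfolding scaleR_add_left scaleR_scaleR by blast
        then have "norm w = ((1 - s) + s * (R / norm u)) * norm u"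
          using s R by (simp add: abs_of_nonneg)
        also have "\<dots> = (1 - s) * norm u + s * R" using pos by (simp add: field_simps)
        also have "\<dots> \<ge> (1 - s) * R + s * R" using s u by (intro add_mono mult_left_mono) auto
        finally show ?thesis using R by (simp add: algebra_simps)
      qed
      then have "\<bar>f u - f ?u\<bar> \<le> K * norm (u - ?u)" by (rule seg)
      also have "u - ?u = (1 - R / norm u) *\<^sub>R u" by (simp add: scaleR_diff_left)
      also have "norm \<dots> = norm u - R" using u pos by (simp add: field_simps abs_of_nonneg)
      finally show "\<bar>f u - f ?u\<bar> \<le> K * norm u"
        using \<open>K > 0\<close> R by (smt (verit) mult_left_mono)
    qed
    have "\<bar>f x - f y\<bar> \<le> K * norm x + K * norm y + 2 * B"
      using rad[OF x] rad[OF y] B(2)[of "(R / norm x) *\<^sub>R x"] B(2)[of "(R / norm y) *\<^sub>R y"] by linarith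
    also have "\<dots> \<le> K * (2 * norm (x - y)) + 2 * (B / R * norm (x - y))"
    proof -
      have "K * norm x + K * norm y = K * (norm x + norm y)" by (simp add: algebra_simps)
      also have "\<dots> \<le> K * (2 * norm (x - y))" using far \<open>K > 0\<close> by (intro mult_left_mono) auto
      finally have 1: "K * norm x + K * norm y \<le> K * (2 * norm (x - y))" .
      have "B / R * R \<le> B / R * norm (x - y)"
        using far x y B R by (intro mult_left_mono) auto
      then show ?thesis using 1 R by simp
    qed
    finally show ?thesis by (simp add: L_def algebra_simps)
  qed
  moreover have "L > 0" using \<open>K > 0\<close> B R by (simp add: L_def add_pos_pos)
  ultimately show ?thesis
    unfolding lipschitz_at_infinity_def lipschitz_on_def using R
    by (intro exI[of _ L] conjI exI[of _ R]) (auto simp: dist_norm)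
qed

section \<open>Descent towards a point from directional bounds\<close>

text \<open>
  Any radius below \<open>1/2\<close> in place of \<open>1/4\<close> would do: the allowed directions \<open>w\<close>, together with an
  equally fine net of unit vectors \<open>v\<close>, must stay within a distance smaller than \<open>1\<close> of the
  direction of descent.
\<close>

definition directionally_bounded :: "('a::real_normed_vector \<Rightarrow> real) \<Rightarrow> bool" where
  "directionally_bounded f \<longleftrightarrow>
     (\<forall>v. \<exists>r. \<forall>\<^sub>F (x, t) in at_infinity \<times>\<^sub>F at_right 0.
        \<exists>w\<in>cball v (1/4). f (x + t *\<^sub>R w) \<le> f x + t * r)"

text \<open>A step \<open>t\<close> along an allowed direction shortens the distance to
  \<open>y\<close> by at least \<open>t / 2\<close> and raises \<open>f\<close> by at most
  \<open>t * r v\<close>, so it suffices that \<open>K\<close> exceeds every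
  \<open>2 * r v\<close>.\<close>

lemma descent_towards:
  fixes f :: "'a::euclidean_space \<Rightarrow> real"
  assumes "directionally_bounded f"
  obtains K M where "K > 0" "\<And>y z. M < norm z \<Longrightarrow> z \<noteq> y \<Longrightarrow>
    \<exists>u. norm (u - y) < norm (z - y) \<and> f u + K * norm (u - y) < f z + K * norm (z - y)"
proof -
  obtain r where r: "\<And>v. \<forall>\<^sub>F (x, t) in at_infinity \<times>\<^sub>F at_right 0.
        \<exists>w\<in>cball v (1/4). f (x + t *\<^sub>R w) \<le> f x + t * r v"
    using assms[unfolded directionally_bounded_def, THEN choice] by blast
  \<comment> \<open>A finite net of the unit sphere, so that one \<open>M\<close>, one
    \<open>\<delta>\<close> and one \<open>K\<close> serve all directions.\<close>
  obtain D where D: "finite D" "sphere (0::'a) 1 \<subseteq> (\<Union>v\<in>D. ball v (1/4))"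
    by (rule compactE_image[of "sphere (0::'a) 1" "sphere 0 1" "\<lambda>v. ball v (1/4)"]) auto
  have "\<forall>\<^sub>F p in at_infinity \<times>\<^sub>F at_right 0. \<forall>v\<in>D. case p of (x, t) \<Rightarrow>
        \<exists>w\<in>cball v (1/4). f (x + t *\<^sub>R w) \<le> f x + t * r v"
    by (intro eventually_ball_finite D ballI r)
  then obtain M \<delta> where "\<delta> > 0" and M: "\<And>x t v. M < norm x \<Longrightarrow> 0 < t \<Longrightarrow> t < \<delta> \<Longrightarrow> v \<in> D \<Longrightarrow>
      \<exists>w\<in>cball v (1/4). f (x + t *\<^sub>R w) \<le> f x + t * r v"
    unfolding eventually_at_infinity_at_right_0 prod.case by blast
  \<comment> \<open>The factor 2 offsets the loss of half the step, the sum dominates each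
    \<open>\<bar>r v\<bar>\<close>, and the 1 makes \<open>K > 0\<close> and
    \<open>2 * r v < K\<close> strict.\<close>
  define K where "K = 1 + 2 * (\<Sum>v\<in>D. \<bar>r v\<bar>)"
  have K: "K > 0" unfolding K_def by (intro add_pos_nonneg mult_nonneg_nonneg sum_nonneg) auto
  have Kr: "2 * r v < K" if "v \<in> D" for v
    using member_le_sum[of v D "\<lambda>v. \<bar>r v\<bar>"] that D(1) unfolding K_def by auto
  show ?thesis
  proof (rule that[OF K])
    fix y z :: 'a assume z: "M < norm z" "z \<noteq> y"
    define d where "d = norm (z - y)"
    define e where "e = (1 / d) *\<^sub>R (y - z)"
    have d: "d > 0" using z by (simp add: d_def)
    have "e \<in> sphere 0 1" using d by (simp add: e_def d_def norm_minus_commute)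
    then obtain v where v: "v \<in> D" "norm (v - e) < 1/4"
      using D(2) by (auto simp: dist_norm)
    \<comment> \<open>\<open>t < d\<close> prevents overshooting \<open>y\<close>: the factor
      \<open>1 - t / d\<close> below stays positive.\<close>
    obtain t where t: "0 < t" "t < \<delta>" "t < d" using field_lbound_gt_zero[OF \<open>\<delta> > 0\<close> d] by blast
    obtain w where w: "norm (v - w) \<le> 1/4" and fw: "f (z + t *\<^sub>R w) \<le> f z + t * r v"
      using M[OF z(1) t(1,2) v(1)] by (auto simp: dist_norm)
    have we: "norm (w - e) \<le> 1/2"
      using v(2) w norm_triangle_le[of "w - v" "v - e" "1/2"] by (simp add: norm_minus_commute)
    let ?u = "z + t *\<^sub>R w"
    \<comment> \<open>An exact move towards \<open>y\<close> plus the error in direction.\<close>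
    have "?u - y = (1 - t / d) *\<^sub>R (z - y) + t *\<^sub>R (w - e)"
      by (simp add: e_def algebra_simps)
    then have "norm (?u - y) \<le> norm ((1 - t / d) *\<^sub>R (z - y)) + norm (t *\<^sub>R (w - e))"
      by (metis norm_triangle_ineq)
    also have "\<dots> = (1 - t / d) * d + t * norm (w - e)" using t d by (simp add: d_def abs_of_nonneg)
    also have "\<dots> \<le> d - t / 2"
    proof -
      have "t * norm (w - e) \<le> t * (1/2)" using we t by (intro mult_left_mono) auto
      moreover have "(1 - t / d) * d = d - t" using d by (simp add: left_diff_distrib)
      ultimately show ?thesis by linarith
    qed
    finally have u: "norm (?u - y) \<le> d - t / 2" .
    have "f ?u + K * norm (?u - y) \<le> f z + t * r v + K * (d - t / 2)"
      using fw u K by (intro add_mono mult_left_mono) auto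
    also have "\<dots> = f z + K * d - t / 2 * (K - 2 * r v)" by (simp add: algebra_simps)
    also have "\<dots> < f z + K * d" using Kr[OF v(1)] t by simp
    finally show "\<exists>u. norm (u - y) < norm (z - y) \<and> f u + K * norm (u - y) < f z + K * norm (z - y)"
      using u t by (intro exI[of _ ?u]) (auto simp: d_def)
  qed
qed

lemma lipschitz_at_infinity_if_directionally_bounded:
  fixes f :: "'a::euclidean_space \<Rightarrow> real"
  assumes lsc: "lower_semicontinuous f" and "directionally_bounded f"
  shows "lipschitz_at_infinity f"
proof -
  obtain K M where K: "K > 0" and desc: "\<And>y z. M < norm z \<Longrightarrow> z \<noteq> y \<Longrightarrow>
    \<exists>u. norm (u - y) < norm (z - y) \<and> f u + K * norm (u - y) < f z + K * norm (z - y)"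
    using descent_towards[OF assms(2)] by metis
  \<comment> \<open>\<open>M + 1 < norm y\<close> keeps the whole unit ball around \<open>y\<close>
    beyond \<open>M\<close>, where descent is available.\<close>
  have key: "f y \<le> f x + K * norm (x - y)" if y: "M + 1 < norm y" and xy: "norm (x - y) \<le> 1" for x y
  proof -
    have "open {z. c < f z + K * norm (z - y)}" for c
      by (intro lower_semicontinuous_open_superlevel lsc continuous_intros)
    then obtain z where z: "z \<in> cball y 1"
      and min: "\<And>u. u \<in> cball y 1 \<Longrightarrow> f z + K * norm (z - y) \<le> f u + K * norm (u - y)"
      using compact_attains_min_if_open_superlevels[of "cball y 1" "\<lambda>z. f z + K * norm (z - y)"]
      by (metis cball_eq_empty compact_cball less_numeral_extra(1) not_less_iff_gr_or_eq)
    have "norm (z - y) \<le> 1" using z by (simp add: dist_norm norm_minus_commute)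
    moreover from this have "M < norm z"
      using y norm_triangle_ineq2[of y z] by (simp add: norm_minus_commute)
    \<comment> \<open>Otherwise descent gives a point nearer to \<open>y\<close>, hence still in the
      ball, with a value below the minimum.\<close>
    ultimately have "z = y"
      using desc[of z y] min by (smt (verit) dist_norm mem_cball norm_minus_commute)
    then show ?thesis using min[of x] xy by (simp add: dist_norm norm_minus_commute)
  qed
  \<comment> \<open>\<open>\<bar>M\<bar> + 2\<close> is positive and exceeds \<open>M + 1\<close>
    whatever the sign of \<open>M\<close>, so \<open>key\<close> applies with either point as
    centre.\<close>
  show ?thesis
  proof (rule lipschitz_at_infinity_if_small_scale[OF _ _ K])
    show "\<bar>M\<bar> + 2 > 0" by simp
  next
    fix a b :: 'a assume "\<bar>M\<bar> + 2 \<le> norm a" "\<bar>M\<bar> + 2 \<le> norm b" "norm (a - b) < 1"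
    then show "\<bar>f a - f b\<bar> \<le> K * norm (a - b)"
      using key[of a b] key[of b a] norm_minus_commute[of a b] by force
  qed
qed

section \<open>Difference quotients and derivatives under a Lipschitz bound\<close>

lemma Limsup_real_bounded:
  assumes "F \<noteq> bot" "\<forall>\<^sub>F x in F. ereal (- B) \<le> g x \<and> g x \<le> ereal B"
  shows "ereal (- B) \<le> Limsup F g" "Limsup F g \<le> ereal B"
proof -
  have "\<forall>\<^sub>F x in F. ereal (- B) \<le> g x" "\<forall>\<^sub>F x in F. g x \<le> ereal B"
    using assms(2) by (auto elim: eventually_mono)
  then show "ereal (- B) \<le> Limsup F g" "Limsup F g \<le> ereal B"
    using le_Limsup[OF assms(1)] Limsup_bounded by auto
qed

lemma abs_ereal_not_infinity:
  assumes "ereal a \<le> x" "x \<le> ereal b"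
  shows "\<bar>x\<bar> \<noteq> \<infinity>"
  using assms by (cases x) auto

lemma diff_quotient_le_iff:
  "t > 0 \<Longrightarrow> diff_quotient f x t w \<le> ereal r \<longleftrightarrow> f (x + t *\<^sub>R w) \<le> f x + t * r"
  by (auto simp: diff_quotient_def field_simps)

text \<open>The margin \<open>B\<close> beyond \<open>R\<close> keeps the moved point outside the
  ball as well, since \<open>t *\<^sub>R w\<close> has norm at most \<open>B\<close>.\<close>

lemma lipschitz_diff_quotient_bounded:
  fixes f :: "'a::real_normed_vector \<Rightarrow> real"
  assumes lip: "L-lipschitz_on (- cball 0 R) f"
    and x: "R + B < norm x" and t: "0 < t" "t < 1" and w: "norm w \<le> B"
  shows "ereal (- (L * B)) \<le> diff_quotient f x t w" "diff_quotient f x t w \<le> ereal (L * B)"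
proof -
  have tw: "norm (t *\<^sub>R w) \<le> B" using t w by (simp add: mult_le_one order.trans[OF mult_left_le_one_le])
  have "norm x - norm (t *\<^sub>R w) \<le> norm (x + t *\<^sub>R w)"
    using norm_triangle_ineq4[of "x + t *\<^sub>R w" "t *\<^sub>R w"] by simp
  then have "x \<in> - cball 0 R" "x + t *\<^sub>R w \<in> - cball 0 R"
    using x tw order.trans[OF norm_ge_zero tw] by auto
  then have "\<bar>f (x + t *\<^sub>R w) - f x\<bar> \<le> L * norm (t *\<^sub>R w)"
    using lipschitz_onD[OF lip, of "x + t *\<^sub>R w" x] by (simp add: dist_norm)
  also have "\<dots> = t * (L * norm w)" using t by simp
  also have "\<dots> \<le> t * (L * B)"
    using t w lipschitz_on_nonneg[OF lip] by (intro mult_left_mono) auto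
  finally have "\<bar>(f (x + t *\<^sub>R w) - f x) / t\<bar> \<le> L * B" using t by (simp add: field_simps abs_of_pos)
  then show "ereal (- (L * B)) \<le> diff_quotient f x t w" "diff_quotient f x t w \<le> ereal (L * B)"
    unfolding diff_quotient_def ereal_less_eq abs_le_iff by linarith+
qed

text \<open>Uniformity in \<open>w\<close> near \<open>v\<close> lets one estimate serve all three
  generalized derivatives.\<close>

lemma eventually_lipschitz_diff_quotient_bounded:
  fixes f :: "'a::real_normed_vector \<Rightarrow> real"
  assumes "L-lipschitz_on (- cball 0 R) f"
  shows "\<forall>\<^sub>F (x, t) in at_infinity \<times>\<^sub>F at_right 0. \<forall>w\<in>cball v 1.
     ereal (- (L * (norm v + 1))) \<le> diff_quotient f x t w \<and> diff_quotient f x t w \<le> ereal (L * (norm v + 1))"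
proof -
  have "norm w \<le> norm v + 1" if "w \<in> cball v 1" for w
    using that norm_triangle_ineq2[of w v] by (simp add: dist_norm norm_minus_commute)
  then show ?thesis
    unfolding eventually_at_infinity_at_right_0
    using lipschitz_diff_quotient_bounded[OF assms, of "norm v + 1"]
    by (intro exI[of _ "R + (norm v + 1)"] exI[of _ 1]) auto
qed

lemma lipschitz_clarke_deriv_finite:
  fixes f :: "'a::euclidean_space \<Rightarrow> real"
  assumes "L-lipschitz_on (- cball 0 R) f"
  shows "\<bar>clarke_deriv_infinity f v\<bar> \<noteq> \<infinity>"
proof -
  have "\<forall>\<^sub>F p in at_infinity \<times>\<^sub>F at_right 0. ereal (- (L * (norm v + 1))) \<le> (case p of (x, t) \<Rightarrow> diff_quotient f x t v)
       \<and> (case p of (x, t) \<Rightarrow> diff_quotient f x t v) \<le> ereal (L * (norm v + 1))"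
    using eventually_lipschitz_diff_quotient_bounded[OF assms, of v] by (rule eventually_mono) auto
  from Limsup_real_bounded[OF at_infinity_at_right_0_nontrivial this] show ?thesis
    unfolding clarke_deriv_infinity_def by (rule abs_ereal_not_infinity)
qed

lemma lipschitz_dagger_deriv_finite:
  fixes f :: "'a::euclidean_space \<Rightarrow> real"
  assumes "L-lipschitz_on (- cball 0 R) f"
  shows "\<bar>dagger_deriv_infinity f v\<bar> \<noteq> \<infinity>"
proof -
  let ?B = "L * (norm v + 1)"
  \<comment> \<open>The triple product nests to the right and has no factor for the pairs
    \<open>(x, t)\<close>, so the estimate is split into its factors and reassembled.\<close>
  obtain P Q where P: "eventually P at_infinity" and Q: "eventually Q (at_right 0)"
    and PQ: "\<And>x t w. P x \<Longrightarrow> Q t \<Longrightarrow> w \<in> cball v 1 \<Longrightarrow>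
       ereal (- ?B) \<le> diff_quotient f x t w \<and> diff_quotient f x t w \<le> ereal ?B"
    using eventually_lipschitz_diff_quotient_bounded[OF assms, of v]
    unfolding eventually_prod_filter by auto
  have C: "\<forall>\<^sub>F w in nhds v. w \<in> cball v 1"
    by (rule eventually_nhds_in_nhd) simp
  have "\<forall>\<^sub>F p in at_right 0 \<times>\<^sub>F nhds v. Q (fst p) \<and> snd p \<in> cball v 1"
    using Q C unfolding eventually_prod_filter by (intro exI[of _ Q] exI[of _ "\<lambda>w. w \<in> cball v 1"]) auto
  with P have "\<forall>\<^sub>F p in at_infinity \<times>\<^sub>F at_right 0 \<times>\<^sub>F nhds v. P (fst p) \<and> Q (fst (snd p)) \<and> snd (snd p) \<in> cball v 1"
    unfolding eventually_prod_filter[of _ at_infinity] by (intro exI[of _ P] exI[of _ "\<lambda>p. Q (fst p) \<and> snd p \<in> cball v 1"]) auto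
  then have "\<forall>\<^sub>F p in at_infinity \<times>\<^sub>F at_right 0 \<times>\<^sub>F nhds v.
       ereal (- ?B) \<le> (case p of (x, t, w) \<Rightarrow> diff_quotient f x t w)
       \<and> (case p of (x, t, w) \<Rightarrow> diff_quotient f x t w) \<le> ereal ?B"
    by (rule eventually_mono) (use PQ in auto)
  moreover have "(at_infinity :: 'a filter) \<times>\<^sub>F at_right (0::real) \<times>\<^sub>F nhds v \<noteq> bot"
    using at_infinity_at_right_0_nontrivial[where 'a = 'a] unfolding prod_filter_eq_bot by simp
  ultimately show ?thesis
    unfolding dagger_deriv_infinity_def using Limsup_real_bounded by (intro abs_ereal_not_infinity)
qed

lemma lipschitz_upper_subderiv_finite:
  fixes f :: "'a::euclidean_space \<Rightarrow> real"
  assumes "L-lipschitz_on (- cball 0 R) f"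
  shows "\<bar>upper_subderiv_infinity f v\<bar> \<noteq> \<infinity>"
proof -
  let ?B = "L * (norm v + 1)"
  let ?g = "\<lambda>\<epsilon>::real. Limsup (at_infinity \<times>\<^sub>F at_right 0) (\<lambda>(x, t). INF w\<in>cball v \<epsilon>. diff_quotient f x t w)"
  \<comment> \<open>The bounds do not depend on \<open>\<epsilon>\<close>, so they survive the
    limit.\<close>
  have "ereal (- ?B) \<le> ?g \<epsilon> \<and> ?g \<epsilon> \<le> ereal ?B" if \<epsilon>: "0 < \<epsilon>" "\<epsilon> < 1" for \<epsilon>
  proof -
    have "\<forall>\<^sub>F p in at_infinity \<times>\<^sub>F at_right 0.
       ereal (- ?B) \<le> (case p of (x, t) \<Rightarrow> INF w\<in>cball v \<epsilon>. diff_quotient f x t w)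
       \<and> (case p of (x, t) \<Rightarrow> INF w\<in>cball v \<epsilon>. diff_quotient f x t w) \<le> ereal ?B"
      using eventually_lipschitz_diff_quotient_bounded[OF assms, of v]
    proof (rule eventually_mono, safe)
      fix x t assume *: "\<forall>w\<in>cball v 1. ereal (- ?B) \<le> diff_quotient f x t w \<and> diff_quotient f x t w \<le> ereal ?B"
      show "ereal (- ?B) \<le> (INF w\<in>cball v \<epsilon>. diff_quotient f x t w)"
        using * \<epsilon> by (intro INF_greatest) auto
      show "(INF w\<in>cball v \<epsilon>. diff_quotient f x t w) \<le> ereal ?B"
        using * \<epsilon> by (intro INF_lower2[of v]) auto
    qed
    from Limsup_real_bounded[OF at_infinity_at_right_0_nontrivial this] show ?thesis by blast
  qed
  then have "\<forall>\<^sub>F \<epsilon> in at_right 0. ereal (- ?B) \<le> ?g \<epsilon> \<and> ?g \<epsilon> \<le> ereal ?B"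
    unfolding eventually_at_right_field by (intro exI[of _ 1]) auto
  then have "ereal (- ?B) \<le> upper_subderiv_infinity f v" "upper_subderiv_infinity f v \<le> ereal ?B"
    using upper_subderiv_infinity_tendsto[of f v]
    by (auto intro: tendsto_lowerbound tendsto_upperbound simp: eventually_conj_iff)
  then show ?thesis by (rule abs_ereal_not_infinity)
qed

section \<open>Directional bounds from finite derivatives\<close>

lemma Limsup_finite_bound:
  fixes g :: "'a \<Rightarrow> ereal"
  assumes "Limsup F g < \<infinity>"
  obtains r where "\<forall>\<^sub>F p in F. g p < ereal r"
proof -
  obtain r where "Limsup F g < ereal r" using ereal_dense2[OF assms] by blast
  from that[OF Limsup_lessD[OF this]] show thesis .
qed

text \<open>A limit below \<open>\<infinity>\<close> forces the upper limit to be below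
  \<open>\<infinity>\<close> for some \<open>\<epsilon>\<close> smaller than the radius 1/4 of
  \<open>directionally_bounded\<close>.\<close>

lemma directionally_bounded_if_upper_subderiv_finite:
  assumes "\<forall>v. upper_subderiv_infinity f v < \<infinity>"
  shows "directionally_bounded f"
  unfolding directionally_bounded_def
proof
  fix v
  let ?g = "\<lambda>\<epsilon>::real. Limsup (at_infinity \<times>\<^sub>F at_right 0) (\<lambda>(x, t). INF w\<in>cball v \<epsilon>. diff_quotient f x t w)"
  have "upper_subderiv_infinity f v < \<infinity>" using assms by blast
  then have "\<forall>\<^sub>F \<epsilon> in at_right 0. ?g \<epsilon> < \<infinity>"
    using order_tendstoD(2)[OF upper_subderiv_infinity_tendsto] by blast
  then obtain d where "d > 0" "\<And>\<epsilon>. 0 < \<epsilon> \<Longrightarrow> \<epsilon> < d \<Longrightarrow> ?g \<epsilon> < \<infinity>"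
    unfolding eventually_at_right_field by auto
  moreover obtain \<epsilon> where \<epsilon>: "0 < \<epsilon>" "\<epsilon> < d" "\<epsilon> < 1/4"
    using field_lbound_gt_zero[OF \<open>d > 0\<close>, of "1/4"] by auto
  ultimately obtain r where r: "\<forall>\<^sub>F p in at_infinity \<times>\<^sub>F at_right 0.
      (case p of (x, t) \<Rightarrow> INF w\<in>cball v \<epsilon>. diff_quotient f x t w) < ereal r"
    using Limsup_finite_bound by blast
  moreover have "\<forall>\<^sub>F p in at_infinity \<times>\<^sub>F at_right 0. snd p > (0::real)"
    unfolding eventually_at_infinity_at_right_0 by (intro exI[of _ 0] exI[of _ 1]) auto
  ultimately have "\<forall>\<^sub>F (x, t) in at_infinity \<times>\<^sub>F at_right 0.
     \<exists>w\<in>cball v (1/4). f (x + t *\<^sub>R w) \<le> f x + t * r"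
  proof eventually_elim
    case (elim p)
    obtain x t where p: "p = (x, t)" by (cases p)
    \<comment> \<open>Strictness yields an actual \<open>w\<close>, although the infimum need not be
      attained.\<close>
    obtain w where "w \<in> cball v \<epsilon>" "diff_quotient f x t w < ereal r"
      using elim(1) unfolding p by (auto simp: INF_less_iff)
    then show ?case
      using elim(2) \<epsilon> diff_quotient_le_iff[of t f x w r] unfolding p by (auto intro!: bexI[of _ w])
  qed
  then show "\<exists>r. \<forall>\<^sub>F (x, t) in at_infinity \<times>\<^sub>F at_right 0.
     \<exists>w\<in>cball v (1/4). f (x + t *\<^sub>R w) \<le> f x + t * r" by blast
qed

lemma directionally_bounded_if_clarke_deriv_finite:
  assumes "\<forall>v. clarke_deriv_infinity f v < \<infinity>"
  shows "directionally_bounded f"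
  unfolding directionally_bounded_def
proof
  fix v
  have "clarke_deriv_infinity f v < \<infinity>" using assms by blast
  then obtain r where "\<forall>\<^sub>F p in at_infinity \<times>\<^sub>F at_right 0. (case p of (x, t) \<Rightarrow> diff_quotient f x t v) < ereal r"
    unfolding clarke_deriv_infinity_def using Limsup_finite_bound by blast
  moreover have "\<forall>\<^sub>F p in at_infinity \<times>\<^sub>F at_right 0. snd p > (0::real)"
    unfolding eventually_at_infinity_at_right_0 by (intro exI[of _ 0] exI[of _ 1]) auto
  ultimately have "\<forall>\<^sub>F (x, t) in at_infinity \<times>\<^sub>F at_right 0.
     \<exists>w\<in>cball v (1/4). f (x + t *\<^sub>R w) \<le> f x + t * r"
    by eventually_elim (auto intro!: bexI[of _ v] simp flip: diff_quotient_le_iff)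
  then show "\<exists>r. \<forall>\<^sub>F (x, t) in at_infinity \<times>\<^sub>F at_right 0.
     \<exists>w\<in>cball v (1/4). f (x + t *\<^sub>R w) \<le> f x + t * r" by blast
qed

lemma clarke_deriv_le_dagger_deriv: "clarke_deriv_infinity f v \<le> dagger_deriv_infinity f v"
proof -
  have "\<forall>\<^sub>F (x, t) in at_infinity \<times>\<^sub>F at_right 0. diff_quotient f x t v < y"
    if "dagger_deriv_infinity f v < y" for y
  proof -
    have "\<forall>\<^sub>F p in at_infinity \<times>\<^sub>F at_right 0 \<times>\<^sub>F nhds v. (case p of (x, t, w) \<Rightarrow> diff_quotient f x t w) < y"
      using that unfolding dagger_deriv_infinity_def by (rule Limsup_lessD)
    then obtain A B C where "eventually A at_infinity" "eventually B (at_right 0)" "C v"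
      and "\<And>x t w. A x \<Longrightarrow> B t \<Longrightarrow> C w \<Longrightarrow> diff_quotient f x t w < y"
      unfolding eventually_prod_filter by (auto dest: eventually_nhds_x_imp_x)
    then show ?thesis
      unfolding eventually_prod_filter by (intro exI[of _ A] exI[of _ B]) auto
  qed
  then show ?thesis
    unfolding clarke_deriv_infinity_def Limsup_le_iff by (auto simp: case_prod_beta')
qed

section \<open>The tangent cone at infinity\<close>

lemma mem_epigraph_UNIV: "(x, y) \<in> epigraph UNIV f \<longleftrightarrow> f x \<le> y"
  by (simp add: epigraph_def)

lemma zero_mem_tangent_cone_infinity: "0 \<in> tangent_cone_infinity E"
  unfolding tangent_cone_infinity_def by (auto intro!: exI[of _ "\<lambda>_. 0"])

lemma tangent_cone_infinityE:
  assumes "z \<in> tangent_cone_infinity E"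
    and "\<forall>k. p k \<in> E" "filterlim (\<lambda>k. norm (fst (p k))) at_top sequentially"
    and "\<forall>k. 0 < t k" "decseq t" "t \<longlonglongrightarrow> 0"
  obtains q where "q \<longlonglongrightarrow> z" "\<forall>k. p k + t k *\<^sub>R q k \<in> E"
proof -
  from assms(1) have "(\<forall>k. p k \<in> E) \<longrightarrow> filterlim (\<lambda>k. norm (fst (p k))) at_top sequentially \<longrightarrow>
      (\<forall>k. 0 < t k) \<longrightarrow> decseq t \<longrightarrow> t \<longlonglongrightarrow> 0 \<longrightarrow>
      (\<exists>q. q \<longlonglongrightarrow> z \<and> (\<forall>k. p k + t k *\<^sub>R q k \<in> E))"
    unfolding tangent_cone_infinity_def by simp
  with assms(2-) that show thesis by auto
qed

text \<open>The factor \<open>c\<close> is absorbed into the step sizes, which still decrease to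
  0.\<close>

lemma tangent_cone_infinity_scaleR:
  assumes "z \<in> tangent_cone_infinity E" "c > 0"
  shows "c *\<^sub>R z \<in> tangent_cone_infinity E"
  unfolding tangent_cone_infinity_def
proof (safe)
  fix p :: "nat \<Rightarrow> 'a \<times> real" and t :: "nat \<Rightarrow> real"
  assume *: "\<forall>k. p k \<in> E" "filterlim (\<lambda>k. norm (fst (p k))) at_top sequentially"
     "\<forall>k. 0 < t k" "decseq t" "t \<longlonglongrightarrow> 0"
  have "\<forall>k. 0 < c * t k" "decseq (\<lambda>k. c * t k)" "(\<lambda>k. c * t k) \<longlonglongrightarrow> 0"
    using * \<open>c > 0\<close> by (auto simp: decseq_def intro: tendsto_mult_right_zero)
  then obtain q where q: "q \<longlonglongrightarrow> z" "\<forall>k. p k + (c * t k) *\<^sub>R q k \<in> E"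
    by (rule tangent_cone_infinityE[OF assms(1) *(1,2)])
  then show "\<exists>q. q \<longlonglongrightarrow> c *\<^sub>R z \<and> (\<forall>k. p k + t k *\<^sub>R q k \<in> E)"
    by (intro exI[of _ "\<lambda>k. c *\<^sub>R q k"]) (auto intro: tendsto_intros simp: mult.commute)
qed

text \<open>The moved base points still escape to infinity, so the second tangent vector can be applied at them.\<close>

lemma tangent_cone_infinity_add:
  assumes "z \<in> tangent_cone_infinity E" "z' \<in> tangent_cone_infinity E"
  shows "z + z' \<in> tangent_cone_infinity E"
  unfolding tangent_cone_infinity_def
proof (safe)
  fix p :: "nat \<Rightarrow> 'a \<times> real" and t :: "nat \<Rightarrow> real"
  assume *: "\<forall>k. p k \<in> E" "filterlim (\<lambda>k. norm (fst (p k))) at_top sequentially"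
     "\<forall>k. 0 < t k" "decseq t" "t \<longlonglongrightarrow> 0"
  from assms(1) * obtain q where q: "q \<longlonglongrightarrow> z" "\<forall>k. p k + t k *\<^sub>R q k \<in> E"
    by (rule tangent_cone_infinityE)
  define p' where "p' = (\<lambda>k. p k + t k *\<^sub>R q k)"
  have "(\<lambda>k. norm (fst (t k *\<^sub>R q k))) \<longlonglongrightarrow> norm (fst (0 *\<^sub>R z))"
    by (intro tendsto_intros * q)
  then have "\<forall>\<^sub>F k in sequentially. norm (fst (t k *\<^sub>R q k)) < 1"
    by (rule order_tendstoD) simp
  then have ev: "\<forall>\<^sub>F k in sequentially. norm (fst (p k)) + - 1 \<le> norm (fst (p' k))"
  proof eventually_elim
    case (elim k)
    then show ?case
      using norm_triangle_ineq4[of "fst (p' k)" "fst (t k *\<^sub>R q k)"] by (simp add: p'_def)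
  qed
  have "filterlim (\<lambda>k. norm (fst (p k)) + - 1) at_top sequentially"
    using *(2) by (subst add.commute) (intro filterlim_tendsto_add_at_top[OF tendsto_const])
  then have "filterlim (\<lambda>k. norm (fst (p' k))) at_top sequentially"
    using ev by (rule filterlim_at_top_mono)
  moreover have "\<forall>k. p' k \<in> E" using q by (simp add: p'_def)
  ultimately obtain q' where q': "q' \<longlonglongrightarrow> z'" "\<forall>k. p' k + t k *\<^sub>R q' k \<in> E"
    using tangent_cone_infinityE[OF assms(2) _ _ *(3-5)] by blast
  then show "\<exists>q. q \<longlonglongrightarrow> z + z' \<and> (\<forall>k. p k + t k *\<^sub>R q k \<in> E)"
    using q by (intro exI[of _ "\<lambda>k. q k + q' k"])
      (auto intro: tendsto_intros simp: p'_def scaleR_add_right add.assoc)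
qed

lemma convex_cone_tangent_cone_infinity: "convex_cone (tangent_cone_infinity E)"
  unfolding convex_cone_iff
proof (intro conjI ballI allI impI)
  fix z and c :: real assume "z \<in> tangent_cone_infinity E" "0 \<le> c"
  then show "c *\<^sub>R z \<in> tangent_cone_infinity E"
    using tangent_cone_infinity_scaleR[of z E c] zero_mem_tangent_cone_infinity[of E]
    by (cases "c = 0") (simp_all add: less_le)
qed (use zero_mem_tangent_cone_infinity tangent_cone_infinity_add in blast)+

text \<open>The bridge from sequences to filters. A failure yields a sequence of bad base points,
  lifted to the graph of \<open>f\<close>; the slack \<open>\<epsilon>\<close> absorbs the
  convergence of both components of the moves \<open>q k\<close>, which then contradict
  badness.\<close>

lemma tangent_cone_infinity_bound:
  fixes f :: "'a::real_normed_vector \<Rightarrow> real"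
  assumes T: "(v, r) \<in> tangent_cone_infinity (epigraph UNIV f)" and "\<epsilon> > 0"
  shows "\<forall>\<^sub>F (x, t) in at_infinity \<times>\<^sub>F at_right 0. \<exists>w\<in>cball v \<epsilon>. f (x + t *\<^sub>R w) \<le> f x + t * (r + \<epsilon>)"
proof (rule ccontr)
  define bad where "bad x t \<longleftrightarrow> (\<forall>w\<in>cball v \<epsilon>. f x + t * (r + \<epsilon>) < f (x + t *\<^sub>R w))" for x t
  assume "\<not> ?thesis"
  then have ex: "\<exists>x t. M < norm x \<and> 0 < t \<and> t < \<delta> \<and> bad x t" if "\<delta> > 0" for M \<delta>
    using that unfolding eventually_at_infinity_at_right_0 bad_def by (force simp: not_le)
  let ?P = "\<lambda>k (x, t). real k < norm x \<and> 0 < t \<and> t < 1 / (real k + 1) \<and> bad x t"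
  \<comment> \<open>The cone tests only decreasing step sizes, so each pair is chosen with knowledge
    of the previous one; the bound \<open>1 / (real k + 1)\<close> forces convergence to 0.\<close>
  have "\<exists>s. \<forall>k. ?P k (s k) \<and> snd (s (Suc k)) < snd (s k)"
  proof (rule dependent_nat_choice)
    show "\<exists>p. ?P 0 p" using ex[of 1 0] by auto
  next
    fix p :: "'a \<times> real" and k assume "?P k p"
    then have "0 < min (snd p) (1 / (real (Suc k) + 1))" by (cases p) auto
    from ex[OF this, of "real (Suc k)"] show "\<exists>p'. ?P (Suc k) p' \<and> snd p' < snd p" by auto
  qed
  then obtain s where s: "\<forall>k. ?P k (s k) \<and> snd (s (Suc k)) < snd (s k)"
    by (elim exE)
  define x where "x k = fst (s k)" for k
  define t where "t k = snd (s k)" for k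
  have st: "real k < norm (x k)" "0 < t k" "t k < 1 / (real k + 1)" "bad (x k) (t k)" for k
    using s[rule_format, of k] by (auto simp: x_def t_def split: prod.splits)
  have 1: "filterlim (\<lambda>k. norm (fst (x k, f (x k)))) at_top sequentially"
    using st(1) by (intro filterlim_at_top_mono[OF filterlim_real_sequentially] always_eventually)
      (auto intro: less_imp_le)
  have 2: "decseq t" using s by (intro decseq_SucI) (auto simp: t_def less_imp_le)
  have 3: "t \<longlonglongrightarrow> 0"
  proof (rule tendsto_sandwich[OF _ _ tendsto_const])
    show "(\<lambda>k. 1 / (real k + 1)) \<longlonglongrightarrow> 0"
      using LIMSEQ_inverse_real_of_nat by (simp add: inverse_eq_divide add.commute)
  qed (use st in \<open>auto intro!: always_eventually less_imp_le\<close>)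
  obtain q where q: "q \<longlonglongrightarrow> (v, r)" "\<forall>k. (x k, f (x k)) + t k *\<^sub>R q k \<in> epigraph UNIV f"
    using T _ 1 _ 2 3 by (rule tangent_cone_infinityE) (simp_all add: mem_epigraph_UNIV st)
  have "(\<lambda>k. fst (q k)) \<longlonglongrightarrow> v" "(\<lambda>k. snd (q k)) \<longlonglongrightarrow> r"
    using tendsto_fst[OF q(1)] tendsto_snd[OF q(1)] by auto
  then have "\<forall>\<^sub>F k in sequentially. dist (fst (q k)) v < \<epsilon> \<and> snd (q k) < r + \<epsilon>"
    using \<open>\<epsilon> > 0\<close> by (intro eventually_conj tendstoD order_tendstoD(2)) auto
  then obtain k where k: "dist (fst (q k)) v < \<epsilon>" "snd (q k) < r + \<epsilon>"
    by (auto dest: eventually_happens)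
  have "f (x k + t k *\<^sub>R fst (q k)) \<le> f (x k) + t k * snd (q k)"
    using q(2)[rule_format, of k] by (cases "q k") (simp add: mem_epigraph_UNIV)
  also have "\<dots> < f (x k) + t k * (r + \<epsilon>)" using k st(2) by simp
  finally show False using st(4)[of k] k(1) unfolding bad_def
    by (metis dist_commute less_eq_real_def mem_cball not_less_iff_gr_or_eq)
qed

text \<open>Far out, a short step \<open>t\<close> along \<open>v\<close> raises \<open>f\<close> by
  at most \<open>t * (L * norm v)\<close>, so the constant move is eventually admissible.\<close>

lemma lipschitz_mem_tangent_cone_infinity:
  fixes f :: "'a::real_normed_vector \<Rightarrow> real"
  assumes lip: "L-lipschitz_on (- cball 0 R) f"
  shows "(v, L * norm v) \<in> tangent_cone_infinity (epigraph UNIV f)"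
  unfolding tangent_cone_infinity_def
proof (safe)
  fix p :: "nat \<Rightarrow> 'a \<times> real" and t :: "nat \<Rightarrow> real"
  assume *: "\<forall>k. p k \<in> epigraph UNIV f" "filterlim (\<lambda>k. norm (fst (p k))) at_top sequentially"
     "\<forall>k. 0 < t k" "decseq t" "t \<longlonglongrightarrow> 0"
  let ?z = "(v, L * norm v)" and ?E = "epigraph UNIV f"
  \<comment> \<open>The definition of the cone demands membership for every \<open>k\<close>;
    indices where the move fails stay put, which does not affect the limit.\<close>
  define q where "q = (\<lambda>k. if p k + t k *\<^sub>R ?z \<in> ?E then ?z else 0)"
  have "\<forall>\<^sub>F k in sequentially. R + norm v < norm (fst (p k))"
    using *(2) by (simp add: filterlim_at_top_dense)
  moreover have "\<forall>\<^sub>F k in sequentially. t k < 1" using *(5) by (rule order_tendstoD) simp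
  ultimately have "\<forall>\<^sub>F k in sequentially. q k = ?z"
  proof eventually_elim
    case (elim k)
    obtain x y where p: "p k = (x, y)" by (cases "p k")
    have "diff_quotient f x (t k) v \<le> ereal (L * norm v)"
      using elim *(3) p by (intro lipschitz_diff_quotient_bounded[OF lip]) auto
    then have "f (x + t k *\<^sub>R v) \<le> f x + t k * (L * norm v)" using *(3) by (simp add: diff_quotient_le_iff)
    moreover have "f x \<le> y" using *(1)[rule_format, of k] by (simp add: p mem_epigraph_UNIV)
    ultimately show ?case by (simp add: q_def p mem_epigraph_UNIV)
  qed
  then have "q \<longlonglongrightarrow> ?z" by (rule tendsto_eventually)
  moreover have "\<forall>k. p k + t k *\<^sub>R q k \<in> ?E" using *(1) by (auto simp: q_def)
  ultimately show "\<exists>q. q \<longlonglongrightarrow> ?z \<and> (\<forall>k. p k + t k *\<^sub>R q k \<in> ?E)" by blast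
qed

text \<open>Tangency would make \<open>f\<close> decrease at a rate close to 1 along very short
  directions, against the Lipschitz bound.\<close>

lemma lipschitz_not_mem_tangent_cone_infinity:
  fixes f :: "'a::euclidean_space \<Rightarrow> real"
  assumes lip: "L-lipschitz_on (- cball 0 R) f"
  shows "(0, - 1) \<notin> tangent_cone_infinity (epigraph UNIV f)"
proof
  assume T: "(0, - 1) \<in> tangent_cone_infinity (epigraph UNIV f)"
  have L: "L \<ge> 0" using lip by (rule lipschitz_on_nonneg)
  \<comment> \<open>Chosen with \<open>(L + 1) * \<epsilon> = 1/2\<close>, so that
    \<open>- 1 + \<epsilon>\<close> falls below the Lipschitz lower bound
    \<open>- (L * \<epsilon>)\<close>.\<close>
  define \<epsilon> where "\<epsilon> = 1 / (2 * (L + 1))"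
  have \<epsilon>: "\<epsilon> > 0" "L * \<epsilon> + \<epsilon> < 1" using L by (auto simp: \<epsilon>_def field_simps add_pos_nonneg)
  have "\<forall>\<^sub>F (x, t) in at_infinity \<times>\<^sub>F at_right 0. R + \<epsilon> < norm (x::'a) \<and> 0 < t \<and> t < (1::real)"
    unfolding eventually_at_infinity_at_right_0 by (intro exI[of _ "R + \<epsilon>"] exI[of _ 1]) auto
  with tangent_cone_infinity_bound[OF T \<epsilon>(1)]
  have "\<forall>\<^sub>F p in at_infinity \<times>\<^sub>F at_right (0::real). (\<lambda>_::'a \<times> real. False) p"
  proof eventually_elim
    case (elim p)
    obtain x t where p: "p = (x, t)" by (cases p)
    have x: "R + \<epsilon> < norm x" "0 < t" "t < 1" using elim(2) by (auto simp: p)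
    obtain w where w: "norm w \<le> \<epsilon>" "f (x + t *\<^sub>R w) \<le> f x + t * (- 1 + \<epsilon>)"
      using elim(1) by (auto simp: p)
    from w(2) have "diff_quotient f x t w \<le> ereal (- 1 + \<epsilon>)"
      using x by (subst diff_quotient_le_iff) auto
    with lipschitz_diff_quotient_bounded(1)[OF lip x w(1)]
    have "ereal (- (L * \<epsilon>)) \<le> ereal (- 1 + \<epsilon>)" by (rule order.trans)
    then show ?case using \<epsilon>(2) by simp
  qed
  then show False using at_infinity_at_right_0_nontrivial by (metis eventually_False)
qed

section \<open>Subgradients and singular subgradients at infinity\<close>

lemma subdiff_infinity_iff:
  "\<xi> \<in> subdiff_infinity f \<longleftrightarrow> (\<forall>(v, r)\<in>tangent_cone_infinity (epigraph UNIV f). v \<bullet> \<xi> \<le> r)"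
  by (auto simp: subdiff_infinity_def normal_cone_infinity_def)

lemma singular_subdiff_infinity_iff:
  "\<xi> \<in> singular_subdiff_infinity f \<longleftrightarrow> (\<forall>(v, r)\<in>tangent_cone_infinity (epigraph UNIV f). v \<bullet> \<xi> \<le> 0)"
  by (auto simp: singular_subdiff_infinity_def normal_cone_infinity_def)

text \<open>A subgradient is tested on the tangent vector over itself,
  \<open>(\<xi>, L * norm \<xi>)\<close>.\<close>

lemma lipschitz_subdiff_infinity_bounded:
  fixes f :: "'a::real_inner \<Rightarrow> real"
  assumes lip: "L-lipschitz_on (- cball 0 R) f" and \<xi>: "\<xi> \<in> subdiff_infinity f"
  shows "norm \<xi> \<le> L"
proof (cases "\<xi> = 0")
  case False
  have "\<xi> \<bullet> \<xi> \<le> L * norm \<xi>"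
    using \<xi> lipschitz_mem_tangent_cone_infinity[OF lip, of \<xi>] unfolding subdiff_infinity_iff by auto
  then show ?thesis using False by (simp add: dot_square_norm power2_eq_square)
qed (use lipschitz_on_nonneg[OF lip] in simp)

lemma closed_subdiff_infinity: "closed (subdiff_infinity f)"
proof -
  have "subdiff_infinity f = (\<Inter>(v, r)\<in>tangent_cone_infinity (epigraph UNIV f). {\<xi>. v \<bullet> \<xi> \<le> r})"
    by (auto simp: subdiff_infinity_iff)
  also have "closed \<dots>" by (auto intro!: closed_INT closed_halfspace_le)
  finally show ?thesis .
qed

text \<open>Separating \<open>(0, - 1)\<close> from the cone gives a normal \<open>(a, b)\<close>.
  Once \<open>b < 0\<close> is known, rescaling the last coordinate to \<open>- 1\<close> gives a
  subgradient.\<close>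

lemma lipschitz_subdiff_infinity_nonempty:
  fixes f :: "'a::euclidean_space \<Rightarrow> real"
  assumes lip: "L-lipschitz_on (- cball 0 R) f"
  shows "subdiff_infinity f \<noteq> {}"
proof -
  let ?T = "tangent_cone_infinity (epigraph UNIV f)"
  have T: "convex ?T" "?T \<noteq> {}" "?T \<inter> {(0, - 1)} = {}"
    using convex_cone_tangent_cone_infinity[of "epigraph UNIV f"] zero_mem_tangent_cone_infinity
      lipschitz_not_mem_tangent_cone_infinity[OF lip] by (auto simp: convex_cone_def)
  from separating_hyperplane_sets[OF T(1) _ T(2) _ T(3)]
  obtain a b c where ab: "(a, b) \<noteq> (0::'a \<times> real)" and le: "\<And>z. z \<in> ?T \<Longrightarrow> (a, b) \<bullet> z \<le> c"
    and ge: "c \<le> - b"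
    by (auto simp: split_paired_Ex)
  have "c \<ge> 0" using le[OF zero_mem_tangent_cone_infinity] by simp
  then have "b \<le> 0" using ge by simp
  \<comment> \<open>A linear functional bounded above on a cone is nonpositive there: otherwise
    scaling reaches the value \<open>c + 1\<close>.\<close>
  have polar: "(a, b) \<bullet> z \<le> 0" if z: "z \<in> ?T" for z
  proof (rule ccontr)
    assume "\<not> ?thesis"
    then have pos: "(a, b) \<bullet> z > 0" by simp
    define s where "s = (c + 1) / ((a, b) \<bullet> z)"
    have "s > 0" using pos \<open>c \<ge> 0\<close> by (simp add: s_def)
    from le[OF tangent_cone_infinity_scaleR[OF z this]] have "c + 1 \<le> c"
      using pos by (simp add: s_def del: inner_Pair)
    then show False by simp
  qed
  \<comment> \<open>Weak separation would allow a horizontal normal; the tangent vector over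
    \<open>a\<close> rules it out.\<close>
  have "b \<noteq> 0"
  proof
    assume "b = 0"
    with polar[OF lipschitz_mem_tangent_cone_infinity[OF lip, of a]] have "a \<bullet> a \<le> 0" by simp
    then have "a = 0" by (simp add: dot_square_norm)
    with ab \<open>b = 0\<close> show False by (simp add: zero_prod_def)
  qed
  with \<open>b \<le> 0\<close> have b: "b < 0" by simp
  have "(1 / - b) *\<^sub>R a \<in> subdiff_infinity f"
    unfolding subdiff_infinity_iff
  proof safe
    fix v r assume "(v, r) \<in> ?T"
    from polar[OF this] have "a \<bullet> v \<le> - b * r" by simp
    then show "v \<bullet> (1 / - b) *\<^sub>R a \<le> r"
      using b by (simp add: inner_commute field_simps)
  qed
  then show ?thesis by blast
qed

lemma lipschitz_singular_subdiff_infinity: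
  fixes f :: "'a::real_inner \<Rightarrow> real"
  assumes lip: "L-lipschitz_on (- cball 0 R) f"
  shows "singular_subdiff_infinity f = {0}"
proof -
  have "\<xi> = 0" if "\<xi> \<in> singular_subdiff_infinity f" for \<xi>
  proof -
    have "\<xi> \<bullet> \<xi> \<le> 0"
      using that lipschitz_mem_tangent_cone_infinity[OF lip, of \<xi>] unfolding singular_subdiff_infinity_iff by auto
    then show ?thesis by (simp add: dot_square_norm)
  qed
  moreover have "0 \<in> singular_subdiff_infinity f" by (auto simp: singular_subdiff_infinity_iff)
  ultimately show ?thesis by auto
qed

lemma singular_subdiff_infinity_trivial_if_bounded:
  assumes \<xi>\<^sub>0: "\<xi>\<^sub>0 \<in> subdiff_infinity f" and bdd: "bounded (subdiff_infinity f)"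
  shows "singular_subdiff_infinity f = {0}"
proof -
  obtain B where B: "\<And>\<xi>. \<xi> \<in> subdiff_infinity f \<Longrightarrow> norm \<xi> \<le> B" using bdd unfolding bounded_iff by auto
  have "\<xi> = 0" if \<xi>: "\<xi> \<in> singular_subdiff_infinity f" for \<xi>
  proof (rule ccontr)
    assume "\<xi> \<noteq> 0"
    \<comment> \<open>Makes the shift along \<open>\<xi>\<close> longer by 1 than the triangle
      inequality permits inside the subdifferential.\<close>
    define s where "s = (B + norm \<xi>\<^sub>0 + 1) / norm \<xi>"
    have "B \<ge> 0" using B[OF \<xi>\<^sub>0] by (rule order.trans[OF norm_ge_zero])
    then have s: "s \<ge> 0" by (simp add: s_def)
    have "\<xi>\<^sub>0 + s *\<^sub>R \<xi> \<in> subdiff_infinity f"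
      unfolding subdiff_infinity_iff
    proof safe
      fix v r assume "(v, r) \<in> tangent_cone_infinity (epigraph UNIV f)"
      then have "v \<bullet> \<xi>\<^sub>0 \<le> r" "v \<bullet> \<xi> \<le> 0"
        using \<xi>\<^sub>0 \<xi> unfolding subdiff_infinity_iff singular_subdiff_infinity_iff by auto
      then show "v \<bullet> (\<xi>\<^sub>0 + s *\<^sub>R \<xi>) \<le> r"
        using mult_nonneg_nonpos[OF s, of "v \<bullet> \<xi>"] by (simp add: inner_add_right)
    qed
    from B[OF this] have "norm (s *\<^sub>R \<xi>) \<le> B + norm \<xi>\<^sub>0"
      using norm_triangle_ineq4[of "\<xi>\<^sub>0 + s *\<^sub>R \<xi>" "\<xi>\<^sub>0"] by simp
    moreover have "norm (s *\<^sub>R \<xi>) = B + norm \<xi>\<^sub>0 + 1"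
      using \<open>B \<ge> 0\<close> \<open>\<xi> \<noteq> 0\<close> by (simp add: s_def)
    ultimately show False by simp
  qed
  moreover have "0 \<in> singular_subdiff_infinity f" by (auto simp: singular_subdiff_infinity_iff)
  ultimately show ?thesis by auto
qed

text \<open>A direction missing from the projected cone is separated from it by some nonzero
  \<open>a\<close>. Being bounded above on a cone, this functional is nonpositive there, so
  \<open>a\<close> is a singular subgradient.\<close>

lemma directionally_bounded_if_singular_subdiff_trivial:
  fixes f :: "'a::euclidean_space \<Rightarrow> real"
  assumes sing: "singular_subdiff_infinity f = {0}"
  shows "directionally_bounded f"
proof -
  let ?T = "tangent_cone_infinity (epigraph UNIV f)"
  have conv: "convex (fst ` ?T)"
    using convex_cone_tangent_cone_infinity[of "epigraph UNIV f"]
    by (intro convex_linear_image linear_fst) (simp add: convex_cone_def)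
  have "v \<in> fst ` ?T" for v
  proof (rule ccontr)
    assume v: "v \<notin> fst ` ?T"
    have "fst ` ?T \<noteq> {}" using zero_mem_tangent_cone_infinity by blast
    then obtain a c where "a \<noteq> 0" and le: "\<And>u. u \<in> fst ` ?T \<Longrightarrow> a \<bullet> u \<le> c"
      using separating_hyperplane_sets[OF conv convex_singleton[of v]] v by auto
    have "c \<ge> 0" using le[of 0] zero_mem_tangent_cone_infinity by (force simp: image_iff)
    have "a \<in> singular_subdiff_infinity f"
      unfolding singular_subdiff_infinity_iff
    proof (safe, rule ccontr)
      fix u r assume u: "(u, r) \<in> ?T" and "\<not> u \<bullet> a \<le> 0"
      then have pos: "u \<bullet> a > 0" by simp
      define s where "s = (c + 1) / (u \<bullet> a)"
      have "s > 0" using pos \<open>c \<ge> 0\<close> by (simp add: s_def)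
      from tangent_cone_infinity_scaleR[OF u this] have "s *\<^sub>R u \<in> fst ` ?T" by force
      from le[OF this] have "c + 1 \<le> c" using pos by (simp add: s_def inner_commute)
      then show False by simp
    qed
    with sing \<open>a \<noteq> 0\<close> show False by simp
  qed
  then have "\<exists>r. (v, r) \<in> ?T" for v by force
  \<comment> \<open>With \<open>\<epsilon> = 1/4\<close> the ball is that of
    \<open>directionally_bounded\<close>, and the rate becomes \<open>r + 1/4\<close>.\<close>
  with tangent_cone_infinity_bound[of _ _ f "1/4"] show ?thesis
    unfolding directionally_bounded_def by (meson zero_less_divide_1_iff zero_less_numeral)
qed

theorem theorem5p8:
  fixes f :: "real ^ 'n \<Rightarrow> real"
  assumes "lower_semicontinuous f"
  shows "(lipschitz_at_infinity f \<longleftrightarrow>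
            subdiff_infinity f \<noteq> {} \<and> compact (subdiff_infinity f)) \<and>
         (lipschitz_at_infinity f \<longleftrightarrow> (\<forall>v. \<bar>upper_subderiv_infinity f v\<bar> \<noteq> \<infinity>)) \<and>
         (lipschitz_at_infinity f \<longleftrightarrow> (\<forall>v. \<bar>dagger_deriv_infinity f v\<bar> \<noteq> \<infinity>)) \<and>
         (lipschitz_at_infinity f \<longleftrightarrow> (\<forall>v. \<bar>clarke_deriv_infinity f v\<bar> \<noteq> \<infinity>)) \<and>
         (lipschitz_at_infinity f \<longleftrightarrow> singular_subdiff_infinity f = {0})"
proof -
  have lip: thesis if "lipschitz_at_infinity f" "\<And>L R. L-lipschitz_on (- cball 0 R) f \<Longrightarrow> thesis" for thesis
    using that unfolding lipschitz_at_infinity_def by blast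
  have fin: "x < \<infinity>" if "\<bar>x\<bar> \<noteq> \<infinity>" for x :: ereal
    using that by auto
  note if_bounded = lipschitz_at_infinity_if_directionally_bounded[OF assms]
  have "lipschitz_at_infinity f \<longleftrightarrow> subdiff_infinity f \<noteq> {} \<and> compact (subdiff_infinity f)"
  proof
    assume "lipschitz_at_infinity f"
    then obtain L R where L: "L-lipschitz_on (- cball 0 R) f" by (rule lip)
    then have "bounded (subdiff_infinity f)"
      using lipschitz_subdiff_infinity_bounded unfolding bounded_iff by blast
    then show "subdiff_infinity f \<noteq> {} \<and> compact (subdiff_infinity f)"
      using lipschitz_subdiff_infinity_nonempty[OF L] closed_subdiff_infinity
      by (simp add: compact_eq_bounded_closed)
  next
    assume "subdiff_infinity f \<noteq> {} \<and> compact (subdiff_infinity f)"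
    then have "singular_subdiff_infinity f = {0}"
      using singular_subdiff_infinity_trivial_if_bounded compact_imp_bounded by blast
    then show "lipschitz_at_infinity f"
      by (intro if_bounded directionally_bounded_if_singular_subdiff_trivial)
  qed
  moreover have "lipschitz_at_infinity f \<longleftrightarrow> (\<forall>v. \<bar>upper_subderiv_infinity f v\<bar> \<noteq> \<infinity>)"
    by (metis lip lipschitz_upper_subderiv_finite fin if_bounded directionally_bounded_if_upper_subderiv_finite)
  \<comment> \<open>For the converse, the dagger derivative dominates the Clarke derivative and so
    bounds it from above.\<close>
  moreover have "lipschitz_at_infinity f \<longleftrightarrow> (\<forall>v. \<bar>dagger_deriv_infinity f v\<bar> \<noteq> \<infinity>)"
    by (metis lip lipschitz_dagger_deriv_finite fin if_bounded
        directionally_bounded_if_clarke_deriv_finite clarke_deriv_le_dagger_deriv order.strict_trans1)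
  moreover have "lipschitz_at_infinity f \<longleftrightarrow> (\<forall>v. \<bar>clarke_deriv_infinity f v\<bar> \<noteq> \<infinity>)"
    by (metis lip lipschitz_clarke_deriv_finite fin if_bounded directionally_bounded_if_clarke_deriv_finite)
  moreover have "lipschitz_at_infinity f \<longleftrightarrow> singular_subdiff_infinity f = {0}"
    by (meson lip lipschitz_singular_subdiff_infinity if_bounded directionally_bounded_if_singular_subdiff_trivial)
  ultimately show ?thesis by blast
qed

end
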